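(* Let $\Omega,\tau,f,\alpha$ satisfy the assumptions listed in the context, with $L_f$ the Lipschitz constant of $\nabla f$. Suppose $L>L_f$ and $\alpha>0$. Assume that $\nabla f$ is completely continuous from $L^2(\Omega)$ to $L^2(\Omega)$, i.e. for all sequences $(v_k)$ in $L^2(\Omega)$, $$v_k\rightharpoonup v\text{ in }L^2(\Omega)\ \Rightarrow\ \nabla f(v_k)\to\nabla f(v)\text{ in }L^2(\Omega).$$ Let $(u_k)$ be a sequence of iterates generated by the proximal gradient algorithm with parameter $L$, let $(\lambda_k)_{k\ge1}$ be the associated multipliers, and suppose $\liminf_{k\to\infty}\lambda_k>0$. Then, for every subsequence $(u_{k_n})$, $u_{k_n}\rightharpoonup\bar u$ in $L^2(\Omega)$ implies $u_{k_n}\to\bar u$ in $L^2(\Omega)$. In addition, for such $\bar u$, for almost all $x\in\Omega$ the following condition is fulfilled: $$\bar u(x)\ne0\quad\Rightarrow\quad\bar u(x)=-\frac1\alpha\nabla f(\bar u)(x).$$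
   Context: For $u\in\mathbb R$, $|u|_0:=1$ if $u\ne0$ and $|0|_0:=0$; for measurable $u:\Omega\to\mathbb R$, $\|u\|_0:=\int_\Omega|u(x)|_0\,dx=\operatorname{meas}\{x:u(x)\ne0\}$. $\mathcal U_\tau:=\{u:\Omega\to\mathbb R\text{ measurable}:\|u\|_0\le\tau\}$. Assumptions: $\Omega\subset\mathbb R^d$ is Lebesgue measurable with $\operatorname{meas}(\Omega)\in(0,\infty)$, $\tau\in(0,\operatorname{meas}(\Omega))$; $f:L^2(\Omega)\to\mathbb R$ is bounded from below and Fréchet differentiable, and $\nabla f:L^2(\Omega)\to L^2(\Omega)$ is Lipschitz continuous with constant $L_f$; $\alpha\ge0$. Proximal gradient algorithm with parameter $L>0$: choose $u_0\in L^2(\Omega)$; for $k=0,1,2,\dots$ let $u_{k+1}$ be a solution of $$(P_k)\quad\min_{u\in\mathcal U_\tau\cap L^2(\Omega)} f(u_k)+\nabla f(u_k)\cdot(u-u_k)+\tfrac L2\|u-u_k\|_{L^2(\Omega)}^2+\tfrac\alpha2\|u\|_{L^2(\Omega)}^2 ,$$ where $\nabla f(u_k)\cdot w=\int_\Omega\nabla f(u_k)w\,dx$. Multipliers: for each $k\ge0$, $\lambda_{k+1}\ge0$ is a number (which exists) such that every solution $u_{k+1}$ of $(P_k)$ satisfies: $\lambda_{k+1}(\|u_{k+1}\|_0-\tau)=0$; $u_{k+1}$ minimizes $f(u_k)+\nabla f(u_k)\cdot(u-u_k)+\frac L2\|u-u_k\|^2_{L^2(\Omega)}+\frac\alpha2\|u\|^2_{L^2(\Omega)}+\lambda_{k+1}\|u\|_0$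 over $u\in L^2(\Omega)$; and for almost all $x\in\Omega$, $u_{k+1}(x)\neq0$ implies $|u_{k+1}(x)|\ge\sqrt{2\lambda_{k+1}/(L+\alpha)}$, and $|u_{k+1}(x)|_0\cdot\big(-\frac1{2(L+\alpha)}(Lu_k(x)-\nabla f(u_k)(x))^2+\lambda_{k+1}\big)\le0$. *)

theory Defs
  imports "HOL-Analysis.Analysis"
begin

text \<open>
  An element of \<open>L\<^sup>2(\<Omega>)\<close> is given by a representative, a function on the whole space of which only
  the values on \<open>\<Omega>\<close> matter. Two representatives denote the same element iff
  \<open>L2_norm \<Omega> (\<lambda>x. u x - v x) = 0\<close>. Maps on \<open>L\<^sup>2(\<Omega>)\<close> are maps on representatives; see
  \<open>has_L2_gradient\<close> and \<open>L2_lipschitz\<close> for their invariance under change of representative.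
\<close>

definition L2_space :: "(real^'d) set \<Rightarrow> (real^'d \<Rightarrow> real) set" where
  "L2_space \<Omega> = {u \<in> borel_measurable (lebesgue_on \<Omega>). integrable (lebesgue_on \<Omega>) (\<lambda>x. (u x)\<^sup>2)}"

definition L2_inner :: "(real^'d) set \<Rightarrow> (real^'d \<Rightarrow> real) \<Rightarrow> (real^'d \<Rightarrow> real) \<Rightarrow> real" where
  "L2_inner \<Omega> u v = (\<integral>x. u x * v x \<partial>lebesgue_on \<Omega>)"

definition L2_norm :: "(real^'d) set \<Rightarrow> (real^'d \<Rightarrow> real) \<Rightarrow> real" where
  "L2_norm \<Omega> u = sqrt (\<integral>x. (u x)\<^sup>2 \<partial>lebesgue_on \<Omega>)"

definition L2_strong_conv ::
    "(real^'d) set \<Rightarrow> (nat \<Rightarrow> real^'d \<Rightarrow> real) \<Rightarrow> (real^'d \<Rightarrow> real) \<Rightarrow> bool" where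
  "L2_strong_conv \<Omega> v w \<longleftrightarrow> (\<forall>n. v n \<in> L2_space \<Omega>) \<and> w \<in> L2_space \<Omega> \<and>
     (\<lambda>n. L2_norm \<Omega> (\<lambda>x. v n x - w x)) \<longlonglongrightarrow> 0"

definition L2_weak_conv ::
    "(real^'d) set \<Rightarrow> (nat \<Rightarrow> real^'d \<Rightarrow> real) \<Rightarrow> (real^'d \<Rightarrow> real) \<Rightarrow> bool" where
  "L2_weak_conv \<Omega> v w \<longleftrightarrow> (\<forall>n. v n \<in> L2_space \<Omega>) \<and> w \<in> L2_space \<Omega> \<and>
     (\<forall>h\<in>L2_space \<Omega>. (\<lambda>n. L2_inner \<Omega> (v n) h) \<longlonglongrightarrow> L2_inner \<Omega> w h)"

text \<open>
  \<open>f\<close> is Frechet differentiable on \<open>L\<^sup>2(\<Omega>)\<close>, and \<open>g u\<close> is the Riesz representative of the derivative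
  at \<open>u\<close>. As increments \<open>h\<close> of norm zero are allowed, this forces \<open>f\<close> to
  take the same value on functions that agree almost everywhere on \<open>\<Omega>\<close>.
\<close>

definition has_L2_gradient ::
    "(real^'d) set \<Rightarrow> ((real^'d \<Rightarrow> real) \<Rightarrow> real) \<Rightarrow> ((real^'d \<Rightarrow> real) \<Rightarrow> (real^'d \<Rightarrow> real)) \<Rightarrow> bool" where
  "has_L2_gradient \<Omega> f g \<longleftrightarrow> (\<forall>u\<in>L2_space \<Omega>. g u \<in> L2_space \<Omega> \<and>
     (\<forall>\<epsilon>>0. \<exists>\<delta>>0. \<forall>h\<in>L2_space \<Omega>. L2_norm \<Omega> h < \<delta> \<longrightarrow>
        \<bar>f (\<lambda>x. u x + h x) - f u - L2_inner \<Omega> (g u) h\<bar> \<le> \<epsilon> * L2_norm \<Omega> h))"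

text \<open>Applied to representatives of the same element, the inequality says that the images are
  again representatives of one element.\<close>

definition L2_lipschitz ::
    "(real^'d) set \<Rightarrow> real \<Rightarrow> ((real^'d \<Rightarrow> real) \<Rightarrow> (real^'d \<Rightarrow> real)) \<Rightarrow> bool" where
  "L2_lipschitz \<Omega> C g \<longleftrightarrow> 0 \<le> C \<and> (\<forall>u\<in>L2_space \<Omega>. \<forall>v\<in>L2_space \<Omega>.
     L2_norm \<Omega> (\<lambda>x. g u x - g v x) \<le> C * L2_norm \<Omega> (\<lambda>x. u x - v x))"

definition L2_completely_continuous ::
    "(real^'d) set \<Rightarrow> ((real^'d \<Rightarrow> real) \<Rightarrow> (real^'d \<Rightarrow> real)) \<Rightarrow> bool" where
  "L2_completely_continuous \<Omega> g \<longleftrightarrow>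
     (\<forall>v w. L2_weak_conv \<Omega> v w \<longrightarrow> L2_strong_conv \<Omega> (\<lambda>n. g (v n)) (g w))"

definition abs0 :: "real \<Rightarrow> real" where
  "abs0 r = (if r \<noteq> 0 then 1 else 0)"

definition L0_norm :: "(real^'d) set \<Rightarrow> (real^'d \<Rightarrow> real) \<Rightarrow> real" where
  "L0_norm \<Omega> u = (\<integral>x. abs0 (u x) \<partial>lebesgue_on \<Omega>)"

definition U_set :: "(real^'d) set \<Rightarrow> real \<Rightarrow> (real^'d \<Rightarrow> real) set" where
  "U_set \<Omega> \<tau> = {u \<in> borel_measurable (lebesgue_on \<Omega>). L0_norm \<Omega> u \<le> \<tau>}"

definition prox_objective ::
    "(real^'d) set \<Rightarrow> ((real^'d \<Rightarrow> real) \<Rightarrow> real) \<Rightarrow> ((real^'d \<Rightarrow> real) \<Rightarrow> (real^'d \<Rightarrow> real)) \<Rightarrow>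
     real \<Rightarrow> real \<Rightarrow> (real^'d \<Rightarrow> real) \<Rightarrow> (real^'d \<Rightarrow> real) \<Rightarrow> real" where
  "prox_objective \<Omega> f g L \<alpha> uk u =
     f uk + L2_inner \<Omega> (g uk) (\<lambda>x. u x - uk x) + L / 2 * (L2_norm \<Omega> (\<lambda>x. u x - uk x))\<^sup>2
       + \<alpha> / 2 * (L2_norm \<Omega> u)\<^sup>2"

definition minimizer_on :: "('b \<Rightarrow> real) \<Rightarrow> 'b set \<Rightarrow> 'b \<Rightarrow> bool" where
  "minimizer_on J S u \<longleftrightarrow> u \<in> S \<and> (\<forall>v\<in>S. J u \<le> J v)"

definition prox_solution ::
    "(real^'d) set \<Rightarrow> real \<Rightarrow> ((real^'d \<Rightarrow> real) \<Rightarrow> real) \<Rightarrow> ((real^'d \<Rightarrow> real) \<Rightarrow> (real^'d \<Rightarrow> real)) \<Rightarrow>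
     real \<Rightarrow> real \<Rightarrow> (real^'d \<Rightarrow> real) \<Rightarrow> (real^'d \<Rightarrow> real) \<Rightarrow> bool" where
  "prox_solution \<Omega> \<tau> f g L \<alpha> uk u \<longleftrightarrow>
     minimizer_on (prox_objective \<Omega> f g L \<alpha> uk) (U_set \<Omega> \<tau> \<inter> L2_space \<Omega>) u"

definition prox_grad_iterates ::
    "(real^'d) set \<Rightarrow> real \<Rightarrow> ((real^'d \<Rightarrow> real) \<Rightarrow> real) \<Rightarrow> ((real^'d \<Rightarrow> real) \<Rightarrow> (real^'d \<Rightarrow> real)) \<Rightarrow>
     real \<Rightarrow> real \<Rightarrow> (nat \<Rightarrow> real^'d \<Rightarrow> real) \<Rightarrow> bool" where
  "prox_grad_iterates \<Omega> \<tau> f g L \<alpha> u \<longleftrightarrow>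
     u 0 \<in> L2_space \<Omega> \<and> (\<forall>k. prox_solution \<Omega> \<tau> f g L \<alpha> (u k) (u (Suc k)))"

definition prox_multiplier ::
    "(real^'d) set \<Rightarrow> real \<Rightarrow> ((real^'d \<Rightarrow> real) \<Rightarrow> real) \<Rightarrow> ((real^'d \<Rightarrow> real) \<Rightarrow> (real^'d \<Rightarrow> real)) \<Rightarrow>
     real \<Rightarrow> real \<Rightarrow> (real^'d \<Rightarrow> real) \<Rightarrow> real \<Rightarrow> bool" where
  "prox_multiplier \<Omega> \<tau> f g L \<alpha> uk \<mu> \<longleftrightarrow> 0 \<le> \<mu> \<and>
     (\<forall>v. prox_solution \<Omega> \<tau> f g L \<alpha> uk v \<longrightarrow>
        \<mu> * (L0_norm \<Omega> v - \<tau>) = 0 \<and>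
        minimizer_on (\<lambda>w. prox_objective \<Omega> f g L \<alpha> uk w + \<mu> * L0_norm \<Omega> w) (L2_space \<Omega>) v \<and>
        (AE x in lebesgue_on \<Omega>.
           (v x \<noteq> 0 \<longrightarrow> \<bar>v x\<bar> \<ge> sqrt (2 * \<mu> / (L + \<alpha>))) \<and>
           abs0 (v x) * (- (1 / (2 * (L + \<alpha>))) * (L * uk x - g uk x)\<^sup>2 + \<mu>) \<le> 0))"

end

theory Submission
  imports Defs
begin

text \<open>
  The energy \<open>f + \<alpha>/2 \<parallel>\<cdot>\<parallel>\<^sup>2\<close> decreases by at least \<open>(L - L\<^sub>f)/2 \<parallel>u\<^sub>k\<^sub>+\<^sub>1 - u\<^sub>k\<parallel>\<^sup>2\<close> in each step, so
  these squared steps are summable. Multipliers bounded away from zero keep \<open>\<bar>u\<^sub>k\<bar>\<close> above a fixed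
  threshold on its support; hence the measures of the support changes are summable too, and almost
  every point changes between support and complement only finitely often. Let \<open>\<sigma>\<close> be the limit of
  the indicators of the supports. On its support, \<open>(L + \<alpha>) u\<^sub>k\<^sub>+\<^sub>1 = L u\<^sub>k - \<nabla>f(u\<^sub>k)\<close>, that is,
  \<open>\<alpha> u\<^sub>k\<^sub>+\<^sub>1 = - \<bar>u\<^sub>k\<^sub>+\<^sub>1\<bar>\<^sub>0 (\<nabla>f(u\<^sub>k) + L (u\<^sub>k\<^sub>+\<^sub>1 - u\<^sub>k))\<close>. Along a weakly convergent subsequence the right side
  converges strongly to \<open>- \<sigma> \<nabla>f(ubar)\<close>, by complete continuity and dominated convergence, and this
  limit must be \<open>\<alpha> ubar\<close>.
\<close>

section \<open>Square-integrable functions: closure properties, inner product and norm\<close>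

lemma L2_space_measurable [measurable_dest]:
  "u \<in> L2_space \<Omega> \<Longrightarrow> u \<in> borel_measurable (lebesgue_on \<Omega>)"
  by (simp add: L2_space_def)

lemma L2_space_integrable_square:
  "u \<in> L2_space \<Omega> \<Longrightarrow> integrable (lebesgue_on \<Omega>) (\<lambda>x. (u x)\<^sup>2)"
  by (simp add: L2_space_def)

lemma L2_space_integrable_mult:
  assumes "u \<in> L2_space \<Omega>" "v \<in> L2_space \<Omega>"
  shows "integrable (lebesgue_on \<Omega>) (\<lambda>x. u x * v x)"
proof (rule Bochner_Integration.integrable_bound)
  show "integrable (lebesgue_on \<Omega>) (\<lambda>x. (u x)\<^sup>2 + (v x)\<^sup>2)"
    using assms by (simp add: L2_space_integrable_square)
  show "(\<lambda>x. u x * v x) \<in> borel_measurable (lebesgue_on \<Omega>)"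
    using assms by (auto simp: L2_space_def)
  have "\<bar>a * b\<bar> \<le> a\<^sup>2 + b\<^sup>2" for a b :: real
  proof -
    have "2 * \<bar>a * b\<bar> \<le> a\<^sup>2 + b\<^sup>2"
      using sum_squares_bound[of "\<bar>a\<bar>" "\<bar>b\<bar>"] by (simp add: abs_mult mult.assoc)
    then show ?thesis using abs_ge_zero[of "a * b"] by linarith
  qed
  then show "AE x in lebesgue_on \<Omega>. norm (u x * v x) \<le> norm ((u x)\<^sup>2 + (v x)\<^sup>2)"
    by simp
qed

lemma L2_space_bounded:
  assumes "v \<in> L2_space \<Omega>" "w \<in> borel_measurable (lebesgue_on \<Omega>)"
    and "AE x in lebesgue_on \<Omega>. \<bar>w x\<bar> \<le> \<bar>v x\<bar>"
  shows "w \<in> L2_space \<Omega>"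
proof -
  have "integrable (lebesgue_on \<Omega>) (\<lambda>x. (w x)\<^sup>2)"
  proof (rule Bochner_Integration.integrable_bound)
    show "integrable (lebesgue_on \<Omega>) (\<lambda>x. (v x)\<^sup>2)"
      using assms(1) by (rule L2_space_integrable_square)
    show "AE x in lebesgue_on \<Omega>. norm ((w x)\<^sup>2) \<le> norm ((v x)\<^sup>2)"
      using assms(3) by (simp add: abs_le_square_iff)
  qed (use assms(2) in simp)
  with assms(2) show ?thesis by (simp add: L2_space_def)
qed

lemma L2_space_cmult:
  "u \<in> L2_space \<Omega> \<Longrightarrow> (\<lambda>x. c * u x) \<in> L2_space \<Omega>"
  by (auto simp: L2_space_def power_mult_distrib)

lemma L2_space_add:
  assumes "u \<in> L2_space \<Omega>" "v \<in> L2_space \<Omega>"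
  shows "(\<lambda>x. u x + v x) \<in> L2_space \<Omega>"
proof -
  have "integrable (lebesgue_on \<Omega>) (\<lambda>x. (u x)\<^sup>2 + (v x)\<^sup>2 + 2 * (u x * v x))"
    using assms by (simp add: L2_space_integrable_square L2_space_integrable_mult)
  then have "integrable (lebesgue_on \<Omega>) (\<lambda>x. (u x + v x)\<^sup>2)"
    by (simp add: power2_sum mult.assoc)
  with assms show ?thesis by (auto simp: L2_space_def)
qed

lemma L2_space_diff:
  "u \<in> L2_space \<Omega> \<Longrightarrow> v \<in> L2_space \<Omega> \<Longrightarrow> (\<lambda>x. u x - v x) \<in> L2_space \<Omega>"
  using L2_space_add[of u \<Omega> "\<lambda>x. (-1) * v x"] L2_space_cmult[of v \<Omega> "-1"] by simp

lemma L2_inner_commute: "L2_inner \<Omega> u v = L2_inner \<Omega> v u"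
  by (simp add: L2_inner_def mult.commute)

lemma L2_inner_add_left:
  assumes "u \<in> L2_space \<Omega>" "v \<in> L2_space \<Omega>" "w \<in> L2_space \<Omega>"
  shows "L2_inner \<Omega> (\<lambda>x. u x + v x) w = L2_inner \<Omega> u w + L2_inner \<Omega> v w"
  using assms by (simp add: L2_inner_def distrib_right L2_space_integrable_mult)

lemma L2_inner_diff_left:
  assumes "u \<in> L2_space \<Omega>" "v \<in> L2_space \<Omega>" "w \<in> L2_space \<Omega>"
  shows "L2_inner \<Omega> (\<lambda>x. u x - v x) w = L2_inner \<Omega> u w - L2_inner \<Omega> v w"
  using assms by (simp add: L2_inner_def left_diff_distrib L2_space_integrable_mult)

lemma L2_inner_cmult_left: "L2_inner \<Omega> (\<lambda>x. c * u x) w = c * L2_inner \<Omega> u w"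
  by (simp add: L2_inner_def mult.assoc)

lemma L2_inner_cmult_right: "L2_inner \<Omega> u (\<lambda>x. c * w x) = c * L2_inner \<Omega> u w"
  by (simp add: L2_inner_def mult.left_commute)

lemma L2_norm_nonneg [simp]: "0 \<le> L2_norm \<Omega> u"
  by (simp add: L2_norm_def)

lemma L2_norm_square: "(L2_norm \<Omega> u)\<^sup>2 = (\<integral>x. (u x)\<^sup>2 \<partial>lebesgue_on \<Omega>)"
  by (simp add: L2_norm_def)

lemma L2_norm_square_inner: "(L2_norm \<Omega> u)\<^sup>2 = L2_inner \<Omega> u u"
  unfolding L2_norm_square by (simp add: L2_inner_def power2_eq_square)

lemma L2_norm_zero [simp]: "L2_norm \<Omega> (\<lambda>x. 0) = 0"
  by (simp add: L2_norm_def)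

lemma L2_norm_cmult: "L2_norm \<Omega> (\<lambda>x. c * u x) = \<bar>c\<bar> * L2_norm \<Omega> u"
  by (simp add: L2_norm_def power_mult_distrib real_sqrt_mult)

lemma L2_norm_eq_0_iff:
  assumes "u \<in> L2_space \<Omega>"
  shows "L2_norm \<Omega> u = 0 \<longleftrightarrow> (AE x in lebesgue_on \<Omega>. u x = 0)"
  using integral_nonneg_eq_0_iff_AE[OF L2_space_integrable_square[OF assms]]
  by (simp add: L2_norm_def)

lemma L2_norm_mono:
  assumes "v \<in> L2_space \<Omega>" "w \<in> borel_measurable (lebesgue_on \<Omega>)"
    and "AE x in lebesgue_on \<Omega>. \<bar>w x\<bar> \<le> \<bar>v x\<bar>"
  shows "L2_norm \<Omega> w \<le> L2_norm \<Omega> v"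
  unfolding L2_norm_def
proof (rule real_sqrt_le_mono, rule integral_mono_AE)
  show "integrable (lebesgue_on \<Omega>) (\<lambda>x. (w x)\<^sup>2)"
    by (intro L2_space_integrable_square L2_space_bounded[OF assms])
  show "AE x in lebesgue_on \<Omega>. (w x)\<^sup>2 \<le> (v x)\<^sup>2"
    using assms(3) by (simp add: abs_le_square_iff)
qed (rule L2_space_integrable_square[OF assms(1)])

lemma L2_norm_square_add:
  assumes "u \<in> L2_space \<Omega>" "v \<in> L2_space \<Omega>"
  shows "(L2_norm \<Omega> (\<lambda>x. u x + v x))\<^sup>2
    = (L2_norm \<Omega> u)\<^sup>2 + 2 * L2_inner \<Omega> u v + (L2_norm \<Omega> v)\<^sup>2"
proof -
  note [simp] = assms L2_space_add
  have "(L2_norm \<Omega> (\<lambda>x. u x + v x))\<^sup>2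
      = L2_inner \<Omega> u (\<lambda>x. u x + v x) + L2_inner \<Omega> v (\<lambda>x. u x + v x)"
    by (simp add: L2_norm_square_inner L2_inner_add_left)
  also have "\<dots> = L2_inner \<Omega> u u + 2 * L2_inner \<Omega> u v + L2_inner \<Omega> v v"
    by (simp add: L2_inner_commute[of \<Omega> _ "\<lambda>x. u x + v x"] L2_inner_add_left
        L2_inner_commute[of \<Omega> v u])
  finally show ?thesis by (simp add: L2_norm_square_inner)
qed

text \<open>The squared norm of \<open>t * u + v\<close> is a quadratic in \<open>t\<close> that is
  never negative; its value at the minimiser gives the inequality. If \<open>u\<close> has norm zero
  there is nothing to divide by, but then \<open>u\<close> vanishes almost everywhere and so does
  the inner product.\<close>

lemma L2_Cauchy_Schwarz:
  assumes "u \<in> L2_space \<Omega>" "v \<in> L2_space \<Omega>"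
  shows "\<bar>L2_inner \<Omega> u v\<bar> \<le> L2_norm \<Omega> u * L2_norm \<Omega> v"
proof -
  have quad: "0 \<le> (L2_norm \<Omega> u)\<^sup>2 * t\<^sup>2 + 2 * L2_inner \<Omega> u v * t + (L2_norm \<Omega> v)\<^sup>2" for t
  proof -
    have "(L2_norm \<Omega> (\<lambda>x. t * u x + v x))\<^sup>2
        = (L2_norm \<Omega> u)\<^sup>2 * t\<^sup>2 + 2 * L2_inner \<Omega> u v * t + (L2_norm \<Omega> v)\<^sup>2"
      using L2_norm_square_add[OF L2_space_cmult[OF assms(1), of t] assms(2)]
      by (simp add: L2_inner_cmult_left L2_norm_cmult power_mult_distrib mult.commute)
    then show ?thesis by (metis zero_le_power2)
  qed
  have "(L2_inner \<Omega> u v)\<^sup>2 \<le> (L2_norm \<Omega> u)\<^sup>2 * (L2_norm \<Omega> v)\<^sup>2"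
  proof (cases "L2_norm \<Omega> u = 0")
    case True
    then have "AE x in lebesgue_on \<Omega>. u x = 0"
      using L2_norm_eq_0_iff[OF assms(1)] by simp
    then have "AE x in lebesgue_on \<Omega>. u x * v x = 0" by eventually_elim simp
    then have "L2_inner \<Omega> u v = 0"
      unfolding L2_inner_def by (rule integral_eq_zero_AE)
    then show ?thesis by simp
  next
    case False
    define a where "a = (L2_norm \<Omega> u)\<^sup>2"
    have "a > 0" using False by (simp add: a_def)
    have "a * (- L2_inner \<Omega> u v / a)\<^sup>2 + 2 * L2_inner \<Omega> u v * (- L2_inner \<Omega> u v / a)
        = - (L2_inner \<Omega> u v)\<^sup>2 / a"
      using \<open>a > 0\<close> by (simp add: divide_simps power2_eq_square)
    with quad[of "- L2_inner \<Omega> u v / a"] have "(L2_inner \<Omega> u v)\<^sup>2 / a \<le> (L2_norm \<Omega> v)\<^sup>2"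
      unfolding a_def[symmetric] by linarith
    with \<open>a > 0\<close> show ?thesis
      unfolding a_def[symmetric] by (simp add: pos_divide_le_eq mult.commute)
  qed
  then have "\<bar>L2_inner \<Omega> u v\<bar> \<le> \<bar>L2_norm \<Omega> u * L2_norm \<Omega> v\<bar>"
    unfolding abs_le_square_iff power_mult_distrib .
  then show ?thesis by (simp add: abs_mult)
qed

lemma L2_norm_triangle:
  assumes "u \<in> L2_space \<Omega>" "v \<in> L2_space \<Omega>"
  shows "L2_norm \<Omega> (\<lambda>x. u x + v x) \<le> L2_norm \<Omega> u + L2_norm \<Omega> v"
proof (rule power2_le_imp_le)
  show "(L2_norm \<Omega> (\<lambda>x. u x + v x))\<^sup>2 \<le> (L2_norm \<Omega> u + L2_norm \<Omega> v)\<^sup>2"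
    using L2_Cauchy_Schwarz[OF assms]
    unfolding L2_norm_square_add[OF assms] power2_sum by linarith
qed simp

section \<open>Calculus along line segments\<close>

text \<open>Chain rule along the line through \<open>u\<close> in direction \<open>h\<close>; it
  reduces estimates of \<open>f\<close> to functions of one real variable.\<close>

lemma L2_gradient_has_real_derivative:
  assumes "has_L2_gradient \<Omega> f g" "u \<in> L2_space \<Omega>" "h \<in> L2_space \<Omega>"
  shows "((\<lambda>t. f (\<lambda>x. u x + t * h x)) has_real_derivative
           L2_inner \<Omega> (g (\<lambda>x. u x + t * h x)) h) (at t)"
proof -
  let ?w = "\<lambda>x. u x + t * h x"
  let ?N = "L2_norm \<Omega> h"
  have w: "?w \<in> L2_space \<Omega>" by (intro L2_space_add L2_space_cmult assms)
  have pos: "?N + 1 > 0" by (smt (verit) L2_norm_nonneg)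
  show ?thesis
    unfolding has_field_derivative_def has_derivative_at_alt
  proof (intro conjI allI impI)
    show "bounded_linear ((*) (L2_inner \<Omega> (g ?w) h))" by (rule bounded_linear_mult_right)
    fix e :: real assume "0 < e"
    \<comment> \<open>The divisor is \<open>?N + 1\<close> rather than \<open>?N\<close> because the
      direction \<open>h\<close> may have norm zero.\<close>
    then have "0 < e / (?N + 1)" using pos by simp
    moreover have "\<forall>\<epsilon>>0. \<exists>\<delta>>0. \<forall>k\<in>L2_space \<Omega>. L2_norm \<Omega> k < \<delta> \<longrightarrow>
        \<bar>f (\<lambda>x. ?w x + k x) - f ?w - L2_inner \<Omega> (g ?w) k\<bar> \<le> \<epsilon> * L2_norm \<Omega> k"
      using bspec[OF assms(1)[unfolded has_L2_gradient_def] w] by (rule conjunct2)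
    ultimately obtain d where d: "d > 0" and d': "\<forall>k\<in>L2_space \<Omega>. L2_norm \<Omega> k < d \<longrightarrow>
        \<bar>f (\<lambda>x. ?w x + k x) - f ?w - L2_inner \<Omega> (g ?w) k\<bar> \<le> e / (?N + 1) * L2_norm \<Omega> k"
      by meson
    show "\<exists>\<delta>>0. \<forall>s. norm (s - t) < \<delta> \<longrightarrow>
        norm (f (\<lambda>x. u x + s * h x) - f ?w - L2_inner \<Omega> (g ?w) h * (s - t)) \<le> e * norm (s - t)"
    proof (intro exI conjI allI impI)
      show "0 < d / (?N + 1)" using d pos by simp
      fix s assume s: "norm (s - t) < d / (?N + 1)"
      let ?k = "\<lambda>x. (s - t) * h x"
      have "\<bar>s - t\<bar> * ?N \<le> \<bar>s - t\<bar> * (?N + 1)" by (simp add: mult_left_mono)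
      also have "\<dots> < d" using s pos by (simp add: pos_less_divide_eq)
      finally have "L2_norm \<Omega> ?k < d" by (simp add: L2_norm_cmult)
      from d'[rule_format, OF L2_space_cmult[OF assms(3)] this]
      have "\<bar>f (\<lambda>x. ?w x + ?k x) - f ?w - L2_inner \<Omega> (g ?w) ?k\<bar>
          \<le> e / (?N + 1) * L2_norm \<Omega> ?k" .
      then have "\<bar>f (\<lambda>x. ?w x + ?k x) - f ?w - L2_inner \<Omega> (g ?w) h * (s - t)\<bar>
          \<le> e / (?N + 1) * (\<bar>s - t\<bar> * ?N)"
        by (simp only: L2_norm_cmult L2_inner_cmult_right mult.commute[of "s - t" "L2_inner _ _ _"])
      also have "\<dots> = (e * \<bar>s - t\<bar>) * (?N / (?N + 1))" by simp
      also have "\<dots> \<le> e * \<bar>s - t\<bar>"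
        using \<open>0 < e\<close> pos by (intro mult_left_le) simp_all
      also have "(\<lambda>x. ?w x + ?k x) = (\<lambda>x. u x + s * h x)" by (simp add: algebra_simps)
      finally show "norm (f (\<lambda>x. u x + s * h x) - f ?w - L2_inner \<Omega> (g ?w) h * (s - t))
          \<le> e * norm (s - t)" by simp
    qed
  qed
qed

text \<open>On the segment from \<open>u\<close> to \<open>u + h\<close>, subtract from
  \<open>f\<close> its quadratic model. By Cauchy-Schwarz and the Lipschitz bound, the derivative of
  the gradient part at \<open>t\<close> exceeds that of the linear model by at most
  \<open>C * t * ?N\<^sup>2\<close>, which the quadratic term absorbs; so the difference
  \<open>?\<phi>\<close> is nonincreasing on [0, 1].\<close>

lemma L2_descent:
  assumes f: "has_L2_gradient \<Omega> f g" and lip: "L2_lipschitz \<Omega> C g"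
    and u: "u \<in> L2_space \<Omega>" and h: "h \<in> L2_space \<Omega>"
  shows "f (\<lambda>x. u x + h x) \<le> f u + L2_inner \<Omega> (g u) h + C / 2 * (L2_norm \<Omega> h)\<^sup>2"
proof -
  let ?N = "L2_norm \<Omega> h"
  let ?w = "\<lambda>t x. u x + t * h x"
  let ?\<phi> = "\<lambda>t. f (?w t) - (t * L2_inner \<Omega> (g u) h + C / 2 * t\<^sup>2 * ?N\<^sup>2)"
  have "?\<phi> 0 \<ge> ?\<phi> 1"
  proof (rule DERIV_nonpos_imp_nonincreasing[of 0 1 ?\<phi>])
    fix t :: real assume "0 \<le> t" "t \<le> 1"
    have w: "?w t \<in> L2_space \<Omega>" by (intro L2_space_add L2_space_cmult u h)
    have gw: "g (?w t) \<in> L2_space \<Omega>" "g u \<in> L2_space \<Omega>"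
      using f w u by (auto simp: has_L2_gradient_def)
    have "L2_inner \<Omega> (g (?w t)) h - L2_inner \<Omega> (g u) h
        \<le> L2_norm \<Omega> (\<lambda>x. g (?w t) x - g u x) * ?N"
      using L2_Cauchy_Schwarz[OF L2_space_diff[OF gw] h] by (simp add: L2_inner_diff_left gw h)
    also have "\<dots> \<le> C * L2_norm \<Omega> (\<lambda>x. ?w t x - u x) * ?N"
      using lip w u unfolding L2_lipschitz_def by (intro mult_right_mono L2_norm_nonneg) blast
    also have "\<dots> = C * t * ?N\<^sup>2"
      using \<open>0 \<le> t\<close> by (simp add: L2_norm_cmult power2_eq_square)
    finally have "L2_inner \<Omega> (g (?w t)) h - (L2_inner \<Omega> (g u) h + C * t * ?N\<^sup>2) \<le> 0" by simp
    moreover have "((\<lambda>t. t * L2_inner \<Omega> (g u) h + C / 2 * t\<^sup>2 * ?N\<^sup>2) has_real_derivative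
        L2_inner \<Omega> (g u) h + C * t * ?N\<^sup>2) (at t)"
      by (auto intro!: derivative_eq_intros)
    note DERIV_diff[OF L2_gradient_has_real_derivative[OF f u h] this]
    ultimately show "\<exists>y. DERIV ?\<phi> t :> y \<and> y \<le> 0" by blast
  qed simp
  then show ?thesis by simp
qed

section \<open>Energy decrease and pointwise stationarity of the iterates\<close>

text \<open>The admissible point \<open>u\<close> itself serves as competitor for \<open>v\<close>.
  Adding the descent inequality with increment \<open>v - u\<close> cancels the gradient term and
  leaves \<open>L / 2 - C / 2\<close> in front of the squared step.\<close>

lemma prox_solution_decrease:
  assumes f: "has_L2_gradient \<Omega> f g" and lip: "L2_lipschitz \<Omega> C g"
    and u: "u \<in> U_set \<Omega> \<tau> \<inter> L2_space \<Omega>" and v: "prox_solution \<Omega> \<tau> f g L \<alpha> u v"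
  shows "f v + \<alpha> / 2 * (L2_norm \<Omega> v)\<^sup>2 + (L - C) / 2 * (L2_norm \<Omega> (\<lambda>x. v x - u x))\<^sup>2
    \<le> f u + \<alpha> / 2 * (L2_norm \<Omega> u)\<^sup>2"
proof -
  have vL: "v \<in> L2_space \<Omega>" and
    "prox_objective \<Omega> f g L \<alpha> u v \<le> prox_objective \<Omega> f g L \<alpha> u u"
    using u v by (auto simp: prox_solution_def minimizer_on_def)
  moreover have "f v \<le> f u + L2_inner \<Omega> (g u) (\<lambda>x. v x - u x)
      + C / 2 * (L2_norm \<Omega> (\<lambda>x. v x - u x))\<^sup>2"
    using L2_descent[OF f lip _ L2_space_diff[OF vL]] u by fastforce
  ultimately show ?thesis
    by (simp add: prox_objective_def L2_inner_def field_simps)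
qed

lemma prox_grad_iterates_in_L2: "prox_grad_iterates \<Omega> \<tau> f g L \<alpha> u \<Longrightarrow> u k \<in> L2_space \<Omega>"
  by (cases k) (auto simp: prox_grad_iterates_def prox_solution_def minimizer_on_def)

text \<open>The decrease telescopes, and the energy is bounded below because \<open>f\<close> is and
  \<alpha> is nonnegative.\<close>

lemma prox_grad_steps_summable:
  assumes f: "has_L2_gradient \<Omega> f g" and lip: "L2_lipschitz \<Omega> C g"
    and bdd: "bdd_below (f ` L2_space \<Omega>)" and "L > C" "\<alpha> \<ge> 0"
    and it: "prox_grad_iterates \<Omega> \<tau> f g L \<alpha> u"
  shows "summable (\<lambda>k. (L2_norm \<Omega> (\<lambda>x. u (Suc k) x - u k x))\<^sup>2)"
proof -
  \<comment> \<open>The energies start at \<open>u 1\<close>: the initial \<open>u 0\<close> may lie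
    outside \<open>U_set \<Omega> \<tau>\<close> and is then no admissible competitor. The one
    missing step does not affect summability.\<close>
  let ?E = "\<lambda>k. f (u (Suc k)) + \<alpha> / 2 * (L2_norm \<Omega> (u (Suc k)))\<^sup>2"
  let ?s = "\<lambda>k. (L2_norm \<Omega> (\<lambda>x. u (Suc k) x - u k x))\<^sup>2"
  obtain m where m: "m \<le> f v" if "v \<in> L2_space \<Omega>" for v
    using bdd by (auto simp: bdd_below_def)
  have E: "m \<le> ?E k" for k
    using m[OF prox_grad_iterates_in_L2[OF it], of "Suc k"] \<open>\<alpha> \<ge> 0\<close>
    by (smt (verit) mult_nonneg_nonneg zero_le_power2 divide_nonneg_nonneg)
  have "?E (Suc k) + (L - C) / 2 * ?s (Suc k) \<le> ?E k" for k
    using it by (intro prox_solution_decrease[OF f lip])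
      (auto simp: prox_grad_iterates_def prox_solution_def minimizer_on_def)
  then have "(L - C) / 2 * (\<Sum>k<n. ?s (Suc k)) \<le> ?E 0 - ?E n" for n
    by (induction n) (simp, smt (verit) sum.lessThan_Suc distrib_left)
  then have *: "(L - C) / 2 * (\<Sum>k<n. ?s (Suc k)) \<le> ?E 0 - m" for n
    using E[of n] by (smt (verit))
  have "(\<Sum>k<n. ?s (Suc k)) \<le> (?E 0 - m) / ((L - C) / 2)" for n
    using *[of n] \<open>L > C\<close> by (simp add: field_simps)
  then have "summable (\<lambda>k. ?s (Suc k))"
    by (intro summableI_nonneg_bounded) auto
  then show ?thesis by (subst (asm) summable_Suc_iff)
qed

text \<open>The competitor replaces \<open>v\<close>, on its support only, by the pointwise minimiser
  \<open>(L u - g u) / (L + \<alpha>)\<close>; completing the square, the objective differs by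
  \<open>(L + \<alpha>)/2\<close> times the squared distance.\<close>

lemma prox_solution_stationary:
  assumes fin: "emeasure lebesgue \<Omega> < \<infinity>" and \<Omega>: "\<Omega> \<in> sets lebesgue"
    and u: "u \<in> L2_space \<Omega>" and gu: "g u \<in> L2_space \<Omega>" and pos: "L + \<alpha> > 0"
    and v: "prox_solution \<Omega> \<tau> f g L \<alpha> u v"
  shows "AE x in lebesgue_on \<Omega>. v x \<noteq> 0 \<longrightarrow> (L + \<alpha>) * v x = L * u x - g u x"
proof -
  let ?M = "lebesgue_on \<Omega>"
  define p where "p x = inverse (L + \<alpha>) * (L * u x - g u x)" for x
  define w where "w x = abs0 (v x) * p x" for x
  interpret finite_measure ?M
    using fin \<Omega> by (intro finite_measureI) (simp add: emeasure_restrict_space)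
  have vL: "v \<in> L2_space \<Omega>" and vU: "v \<in> U_set \<Omega> \<tau>"
    and min: "\<And>z. z \<in> U_set \<Omega> \<tau> \<Longrightarrow> z \<in> L2_space \<Omega> \<Longrightarrow>
      prox_objective \<Omega> f g L \<alpha> u v \<le> prox_objective \<Omega> f g L \<alpha> u z"
    using v by (auto simp: prox_solution_def minimizer_on_def)
  note [measurable] = L2_space_measurable[OF vL] L2_space_measurable[OF u]
    L2_space_measurable[OF gu]
  have [measurable]: "w \<in> borel_measurable ?M"
    unfolding w_def p_def abs0_def by measurable
  have "p \<in> L2_space \<Omega>"
    unfolding p_def by (intro L2_space_cmult L2_space_diff u gu)
  then have wL: "w \<in> L2_space \<Omega>"
    by (rule L2_space_bounded) (simp_all add: w_def abs0_def)
  \<comment> \<open>\<open>w\<close> vanishes wherever \<open>v\<close> does, so it inherits the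
    constraint on the support and is admissible.\<close>
  have "L0_norm \<Omega> w \<le> L0_norm \<Omega> v"
    unfolding L0_norm_def
  proof (rule integral_mono)
    show "integrable ?M (\<lambda>x. abs0 (w x))" "integrable ?M (\<lambda>x. abs0 (v x))"
      by (rule integrable_const_bound[of _ 1]; simp add: abs0_def)+
  qed (simp add: w_def abs0_def)
  then have wU: "w \<in> U_set \<Omega> \<tau>" using vU by (simp add: U_set_def)
  have sq: "z \<in> L2_space \<Omega> \<Longrightarrow> integrable ?M (\<lambda>x. (z x)\<^sup>2)" for z
    by (rule L2_space_integrable_square)
  let ?q = "\<lambda>z x. g u x * (z x - u x) + L / 2 * (z x - u x)\<^sup>2 + \<alpha> / 2 * (z x)\<^sup>2"
  have obj: "prox_objective \<Omega> f g L \<alpha> u z = f u + (\<integral>x. ?q z x \<partial>?M)" and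
    int: "integrable ?M (?q z)" if "z \<in> L2_space \<Omega>" for z
    using that sq[of z] sq[OF L2_space_diff[OF that u]]
      L2_space_integrable_mult[OF gu L2_space_diff[OF that u]]
    by (simp_all add: prox_objective_def L2_norm_square L2_inner_def)
  have "(L + \<alpha>) / 2 * (L2_norm \<Omega> (\<lambda>x. v x - w x))\<^sup>2 = (\<integral>x. ?q v x - ?q w x \<partial>?M)"
    unfolding L2_norm_square integral_mult_right_zero[symmetric]
  proof (rule arg_cong[where f = "integral\<^sup>L ?M"], rule ext)
    fix x
    show "(L + \<alpha>) / 2 * (v x - w x)\<^sup>2 = ?q v x - ?q w x"
    proof (cases "v x = 0")
      case False
      have "L * u x - g u x = (L + \<alpha>) * w x"
        using pos False by (simp add: w_def p_def abs0_def)
      then have "g u x = L * u x - (L + \<alpha>) * w x" by simp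
      then show ?thesis by (simp only:) (simp add: field_simps power2_eq_square)
    qed (simp add: w_def abs0_def)
  qed
  also have "\<dots> = prox_objective \<Omega> f g L \<alpha> u v - prox_objective \<Omega> f g L \<alpha> u w"
    using obj int vL wL by simp
  also have "\<dots> \<le> 0" using min[OF wU wL] by simp
  finally have "L2_norm \<Omega> (\<lambda>x. v x - w x) = 0"
    using pos by (simp add: mult_le_0_iff)
  then have "AE x in ?M. v x - w x = 0"
    using L2_norm_eq_0_iff[OF L2_space_diff[OF vL wL]] by simp
  then show ?thesis
  proof eventually_elim
    case (elim x)
    then show ?case using pos by (auto simp: w_def p_def abs0_def)
  qed
qed

section \<open>Identification of limits and stabilisation of the supports\<close>

text \<open>Tested with \<open>a - b\<close> itself, the inner products with \<open>v n - b\<close>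
  tend to 0 by strong convergence and to the squared norm of \<open>a - b\<close> by weak
  convergence.\<close>

lemma L2_weak_limit_eq_strong_limit:
  assumes weak: "L2_weak_conv \<Omega> v a" and strong: "L2_strong_conv \<Omega> v b"
  shows "AE x in lebesgue_on \<Omega>. a x = b x"
proof -
  have v: "\<And>n. v n \<in> L2_space \<Omega>" and a: "a \<in> L2_space \<Omega>" and b: "b \<in> L2_space \<Omega>"
    using weak strong by (auto simp: L2_weak_conv_def L2_strong_conv_def)
  let ?h = "\<lambda>x. a x - b x"
  have h: "?h \<in> L2_space \<Omega>" by (intro L2_space_diff a b)
  have "(\<lambda>n. L2_norm \<Omega> (\<lambda>x. v n x - b x) * L2_norm \<Omega> ?h) \<longlonglongrightarrow> 0"
    using strong by (intro tendsto_mult_left_zero) (simp add: L2_strong_conv_def)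
  then have "(\<lambda>n. L2_inner \<Omega> (\<lambda>x. v n x - b x) ?h) \<longlonglongrightarrow> 0"
    by (rule Lim_null_comparison[rotated])
      (simp add: L2_Cauchy_Schwarz L2_space_diff v b h)
  moreover have "(\<lambda>n. L2_inner \<Omega> (\<lambda>x. v n x - b x) ?h) \<longlonglongrightarrow> L2_inner \<Omega> a ?h - L2_inner \<Omega> b ?h"
    using weak h unfolding L2_inner_diff_left[OF v b h] L2_weak_conv_def
    by (intro tendsto_diff tendsto_const) blast
  ultimately have "L2_inner \<Omega> a ?h - L2_inner \<Omega> b ?h = 0"
    using LIMSEQ_unique by blast
  then have "L2_norm \<Omega> ?h = 0"
    using L2_norm_square_inner[of \<Omega> ?h] by (simp add: L2_inner_diff_left[OF a b h])
  then show ?thesis using L2_norm_eq_0_iff[OF h] by simp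
qed

text \<open>Where exactly one of two consecutive members vanishes, they differ by at least \<open>s\<close>, so the
  measures of these sets are summable and Borel--Cantelli applies.\<close>

lemma support_eventually_constant_AE:
  assumes v: "\<And>k. v k \<in> L2_space \<Omega>" and "s > 0"
    and gap: "\<And>k. k \<ge> K \<Longrightarrow> AE x in lebesgue_on \<Omega>. v k x \<noteq> 0 \<longrightarrow> \<bar>v k x\<bar> \<ge> s"
    and fin: "finite_measure (lebesgue_on \<Omega>)"
    and sum: "summable (\<lambda>k. (L2_norm \<Omega> (\<lambda>x. v (Suc k) x - v k x))\<^sup>2)"
  shows "AE x in lebesgue_on \<Omega>. \<exists>N. \<forall>k\<ge>N. abs0 (v k x) = abs0 (v N x)"
proof -
  let ?M = "lebesgue_on \<Omega>"
  interpret finite_measure ?M by (rule fin)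
  define A where "A k = {x \<in> space ?M. abs0 (v (Suc k) x) \<noteq> abs0 (v k x)}" for k
  note [measurable] = L2_space_measurable[OF v]
  have A [measurable]: "A k \<in> sets ?M" for k
    unfolding A_def abs0_def by measurable
  have "measure ?M (A k) \<le> (L2_norm \<Omega> (\<lambda>x. v (Suc k) x - v k x))\<^sup>2 / s\<^sup>2" if "k \<ge> K" for k
  proof -
    \<comment> \<open>Chebyshev's inequality for the squared increment.\<close>
    have "s\<^sup>2 * measure ?M (A k) = (\<integral>x. s\<^sup>2 * indicator (A k) x \<partial>?M)"
      using sets.Int_space_eq2[OF A[of k]] by simp
    also have "\<dots> \<le> (\<integral>x. (v (Suc k) x - v k x)\<^sup>2 \<partial>?M)"
    proof (rule integral_mono_AE)
      show "integrable ?M (\<lambda>x. s\<^sup>2 * indicator (A k) x)"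
        by (intro integrable_mult_right integrable_real_indicator A) (simp add: emeasure_finite less_top[symmetric])
      show "integrable ?M (\<lambda>x. (v (Suc k) x - v k x)\<^sup>2)"
        by (intro L2_space_integrable_square L2_space_diff v)
      show "AE x in ?M. s\<^sup>2 * indicator (A k) x \<le> (v (Suc k) x - v k x)\<^sup>2"
        using gap[OF that] gap[OF le_SucI[OF that]]
      proof eventually_elim
        case (elim x)
        have "s \<le> \<bar>v (Suc k) x - v k x\<bar>" if "x \<in> A k"
          using elim that by (auto simp: A_def abs0_def split: if_splits)
        then show ?case
          using \<open>s > 0\<close> abs_le_square_iff[of s "v (Suc k) x - v k x"]
          by (auto simp: indicator_def)
      qed
    qed
    finally show ?thesis
      using \<open>s > 0\<close> by (simp add: L2_norm_square field_simps)
  qed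
  then have "summable (\<lambda>k. measure ?M (A k))"
    by (intro summable_comparison_test'[OF summable_divide[OF sum, of "s\<^sup>2"], of K]) auto
  then have "AE x in ?M. eventually (\<lambda>k. x \<in> space ?M - A k) sequentially"
    by (intro borel_cantelli_AE1 A) (simp_all add: emeasure_finite less_top[symmetric])
  then show ?thesis
  proof eventually_elim
    case (elim x)
    then obtain N where N: "\<And>k. k \<ge> N \<Longrightarrow> abs0 (v (Suc k) x) = abs0 (v k x)"
      by (auto simp: A_def eventually_sequentially)
    have "abs0 (v k x) = abs0 (v N x)" if "k \<ge> N" for k
      using that by (induction k rule: dec_induct) (simp_all add: N)
    then show ?case by blast
  qed
qed

text \<open>Dominated convergence with majorant \<open>h\<^sup>2\<close>. It serves to replace the
  support indicators by their pointwise limit in front of a fixed function.\<close>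

lemma L2_norm_mult_tendsto_0:
  assumes h: "h \<in> L2_space \<Omega>" and [measurable]: "\<And>k. c k \<in> borel_measurable (lebesgue_on \<Omega>)"
    and bound: "\<And>k. AE x in lebesgue_on \<Omega>. \<bar>c k x\<bar> \<le> 1"
    and lim: "AE x in lebesgue_on \<Omega>. (\<lambda>k. c k x) \<longlonglongrightarrow> 0"
  shows "(\<lambda>k. L2_norm \<Omega> (\<lambda>x. c k x * h x)) \<longlonglongrightarrow> 0"
proof -
  note [measurable] = L2_space_measurable[OF h]
  have "(\<lambda>k. \<integral>x. (c k x * h x)\<^sup>2 \<partial>lebesgue_on \<Omega>) \<longlonglongrightarrow> (\<integral>x. 0 \<partial>lebesgue_on \<Omega>)"
  proof (rule integral_dominated_convergence)
    show "integrable (lebesgue_on \<Omega>) (\<lambda>x. (h x)\<^sup>2)" by (rule L2_space_integrable_square[OF h])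
    show "AE x in lebesgue_on \<Omega>. (\<lambda>k. (c k x * h x)\<^sup>2) \<longlonglongrightarrow> 0"
      using lim by eventually_elim (auto intro!: tendsto_eq_intros)
    show "AE x in lebesgue_on \<Omega>. norm ((c k x * h x)\<^sup>2) \<le> (h x)\<^sup>2" for k
      using bound[of k]
      by eventually_elim (simp add: power_mult_distrib abs_square_le_1 mult_left_le_one_le)
  qed simp_all
  then show ?thesis
    unfolding L2_norm_def using tendsto_real_sqrt by fastforce
qed

section \<open>Strong convergence and the limit condition\<close>

theorem theorem5p7:
  fixes \<Omega> :: "(real^'d) set"
    and f :: "(real^'d \<Rightarrow> real) \<Rightarrow> real"
    and grad_f :: "(real^'d \<Rightarrow> real) \<Rightarrow> (real^'d \<Rightarrow> real)"
    and \<tau> \<alpha> L L\<^sub>f :: real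
    and u :: "nat \<Rightarrow> real^'d \<Rightarrow> real"
    and lam :: "nat \<Rightarrow> real"
  assumes "\<Omega> \<in> sets lebesgue"
    and "0 < emeasure lebesgue \<Omega>" and "emeasure lebesgue \<Omega> < \<infinity>"
    and "0 < \<tau>" and "\<tau> < measure lebesgue \<Omega>"
    and "bdd_below (f ` L2_space \<Omega>)"
    and "has_L2_gradient \<Omega> f grad_f"
    and "L2_lipschitz \<Omega> L\<^sub>f grad_f"
    and "L > 0" and "L > L\<^sub>f" and "\<alpha> > 0"
    and "L2_completely_continuous \<Omega> grad_f"
    and "prox_grad_iterates \<Omega> \<tau> f grad_f L \<alpha> u"
    and "\<And>k. prox_multiplier \<Omega> \<tau> f grad_f L \<alpha> (u k) (lam (Suc k))"
    and "liminf (\<lambda>k. ereal (lam k)) > 0"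
  shows "\<forall>r ubar. strict_mono r \<longrightarrow> L2_weak_conv \<Omega> (\<lambda>n. u (r n)) ubar \<longrightarrow>
           L2_strong_conv \<Omega> (\<lambda>n. u (r n)) ubar \<and>
           (AE x in lebesgue_on \<Omega>. ubar x \<noteq> 0 \<longrightarrow> ubar x = - (1 / \<alpha>) * grad_f ubar x)"
proof (intro allI impI)
  fix r :: "nat \<Rightarrow> nat" and ubar
  assume r: "strict_mono r" and weak: "L2_weak_conv \<Omega> (\<lambda>n. u (r n)) ubar"
  let ?M = "lebesgue_on \<Omega>"
  define d where "d k = L2_norm \<Omega> (\<lambda>x. u (Suc k) x - u k x)" for k
  have fin: "finite_measure ?M"
    using assms(1,3) by (intro finite_measureI) (simp add: emeasure_restrict_space)
  have uL: "u k \<in> L2_space \<Omega>" for k by (rule prox_grad_iterates_in_L2) fact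
  have gL: "v \<in> L2_space \<Omega> \<Longrightarrow> grad_f v \<in> L2_space \<Omega>" for v
    using assms(7) by (simp add: has_L2_gradient_def)
  have ubarL: "ubar \<in> L2_space \<Omega>" using weak by (simp add: L2_weak_conv_def)
  have step: "prox_solution \<Omega> \<tau> f grad_f L \<alpha> (u k) (u (Suc k))" for k
    using assms(13) by (simp add: prox_grad_iterates_def)
  note [measurable] = L2_space_measurable[OF uL] L2_space_measurable[OF gL[OF ubarL]]
  have "summable (\<lambda>k. (d k)\<^sup>2)"
    unfolding d_def using assms(11)
    by (intro prox_grad_steps_summable[OF assms(7,8,6,10) _ assms(13)]) simp
  then have d_lim: "d \<longlonglongrightarrow> 0"
    using summable_LIMSEQ_zero by fastforce

  \<comment> \<open>Any number strictly between 0 and the limes inferior is finite and bounds the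
    multipliers from below from some index \<open>K\<close> on.\<close>
  obtain c where c: "0 < c" "c < liminf (\<lambda>k. ereal (lam k))"
    using assms(15) dense by blast
  then obtain c' where c': "c = ereal c'"
    by (cases c) auto
  from less_LiminfD[OF c(2)] obtain K where K: "\<And>k. k \<ge> K \<Longrightarrow> c' < lam k"
    by (auto simp: c' eventually_sequentially)
  have const: "AE x in ?M. \<exists>N. \<forall>k\<ge>N. abs0 (u k x) = abs0 (u N x)"
  \<comment> \<open>The bound for \<open>u k\<close> comes from the subproblem at
    \<open>u (k - 1)\<close>, whose multiplier is \<open>lam k\<close>. Starting at
    \<open>Suc K\<close> ensures both \<open>k \<ge> 1\<close> and
    \<open>lam k > c'\<close>.\<close>
  proof (rule support_eventually_constant_AE[OF uL, of "sqrt (2 * c' / (L + \<alpha>))" "Suc K"])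
    show "0 < sqrt (2 * c' / (L + \<alpha>))" using c c' assms(9,11) by simp
    show "AE x in ?M. u k x \<noteq> 0 \<longrightarrow> sqrt (2 * c' / (L + \<alpha>)) \<le> \<bar>u k x\<bar>" if "Suc K \<le> k" for k
    proof -
      from that obtain m where m: "k = Suc m" by (cases k) auto
      have le: "sqrt (2 * c' / (L + \<alpha>)) \<le> sqrt (2 * lam k / (L + \<alpha>))"
        using K[of k] that assms(9,11) by (simp add: divide_right_mono)
      have "AE x in ?M. u k x \<noteq> 0 \<longrightarrow> \<bar>u k x\<bar> \<ge> sqrt (2 * lam k / (L + \<alpha>))"
        using assms(14)[of m] step[of m] unfolding prox_multiplier_def m by fastforce
      then show ?thesis by eventually_elim (blast intro: order_trans[OF le])
    qed
  qed (use fin \<open>summable (\<lambda>k. (d k)\<^sup>2)\<close> in \<open>simp_all add: d_def\<close>)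

  \<comment> \<open>Where the indicators do not settle, \<open>lim\<close> gives a value without
    meaning; this happens only on a null set.\<close>
  define \<sigma> where "\<sigma> x = lim (\<lambda>k. abs0 (u k x))" for x
  have [measurable]: "(\<lambda>x. abs0 (u k x)) \<in> borel_measurable ?M" for k
    unfolding abs0_def by measurable
  have [measurable]: "\<sigma> \<in> borel_measurable ?M" unfolding \<sigma>_def by measurable
  from const have \<sigma>: "AE x in ?M. (\<lambda>k. abs0 (u k x)) \<longlonglongrightarrow> \<sigma> x \<and> \<sigma> x \<in> {0, 1}"
  proof eventually_elim
    case (elim x)
    then obtain N where "\<And>k. k \<ge> N \<Longrightarrow> abs0 (u k x) = abs0 (u N x)" by blast
    then have "(\<lambda>k. abs0 (u k x)) \<longlonglongrightarrow> abs0 (u N x)"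
      by (intro tendsto_eventually eventually_sequentiallyI[of N])
    then show ?case by (auto simp: \<sigma>_def limI abs0_def)
  qed
  \<comment> \<open>The candidate limit, built from the gradient at \<open>ubar\<close>. Strong
    convergence to \<open>w\<close> is proved first; \<open>w\<close> is identified with
    \<open>ubar\<close> afterwards.\<close>
  define w where "w x = - (1 / \<alpha>) * (\<sigma> x * grad_f ubar x)" for x
  have wL: "w \<in> L2_space \<Omega>"
    unfolding w_def
  proof (intro L2_space_cmult L2_space_bounded[OF gL[OF ubarL]])
    show "AE x in ?M. \<bar>\<sigma> x * grad_f ubar x\<bar> \<le> \<bar>grad_f ubar x\<bar>"
      using \<sigma> by eventually_elim auto
  qed simp
  define e where "e k x = (abs0 (u k x) - \<sigma> x) * grad_f ubar x" for k x
  have bound: "AE x in ?M. \<bar>abs0 (u k x) - \<sigma> x\<bar> \<le> 1" for k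
    using \<sigma> by eventually_elim (auto simp: abs0_def)
  have eL: "e k \<in> L2_space \<Omega>" for k
  proof (rule L2_space_bounded[OF gL[OF ubarL]])
    show "AE x in ?M. \<bar>e k x\<bar> \<le> \<bar>grad_f ubar x\<bar>"
      using bound[of k] by eventually_elim (simp add: e_def abs_mult mult_left_le_one_le)
  qed (simp add: e_def[abs_def])
  have e_lim: "(\<lambda>k. L2_norm \<Omega> (e k)) \<longlonglongrightarrow> 0"
    unfolding e_def
  proof (rule L2_norm_mult_tendsto_0[OF gL[OF ubarL] _ bound])
    show "AE x in ?M. (\<lambda>k. abs0 (u k x) - \<sigma> x) \<longlonglongrightarrow> 0"
      using \<sigma> by eventually_elim (auto intro!: tendsto_eq_intros)
  qed simp

  \<comment> \<open>Four errors: exchanging the gradient at \<open>u (k - 1)\<close> for that at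
    \<open>u k\<close>, the proximal term, exchanging the gradient at \<open>u k\<close> for that at
    \<open>ubar\<close>, and exchanging the support of \<open>u k\<close> for \<sigma>. The detour
    through \<open>u k\<close> is made because complete continuity will be applied along
    \<open>r n\<close>, not along \<open>r n - 1\<close>.\<close>
  have est: "\<alpha> * L2_norm \<Omega> (\<lambda>x. u k x - w x)
      \<le> L\<^sub>f * d (k - 1) + (L * d (k - 1) + (L2_norm \<Omega> (\<lambda>x. grad_f (u k) x - grad_f ubar x)
        + L2_norm \<Omega> (e k)))" if "k \<ge> 1" for k
  proof -
    from that obtain m where k: "k = Suc m" by (cases k) auto
    let ?a = "\<lambda>x. \<bar>grad_f (u k) x - grad_f (u m) x\<bar>"
    let ?b = "\<lambda>x. L * \<bar>u k x - u m x\<bar>"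
    let ?c = "\<lambda>x. \<bar>grad_f (u k) x - grad_f ubar x\<bar>"
    let ?e = "\<lambda>x. \<bar>e k x\<bar>"
    have absL: "v \<in> L2_space \<Omega> \<Longrightarrow> (\<lambda>x. \<bar>v x\<bar>) \<in> L2_space \<Omega>" for v
      by (auto simp: L2_space_def)
    have abs_norm: "L2_norm \<Omega> (\<lambda>x. \<bar>v x\<bar>) = L2_norm \<Omega> v" for v
      by (simp add: L2_norm_def)
    have L: "?a \<in> L2_space \<Omega>" "?b \<in> L2_space \<Omega>" "?c \<in> L2_space \<Omega>" "?e \<in> L2_space \<Omega>"
      by (intro absL L2_space_cmult L2_space_diff gL uL ubarL eL)+
    have "AE x in ?M. u k x \<noteq> 0 \<longrightarrow> (L + \<alpha>) * u k x = L * u m x - grad_f (u m) x"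
      unfolding k using assms(1,3,9,11)
      by (intro prox_solution_stationary[OF _ _ uL gL[OF uL] _ step]) auto
    then have ae: "AE x in ?M. \<bar>\<alpha> * (u k x - w x)\<bar> \<le> \<bar>?a x + (?b x + (?c x + ?e x))\<bar>"
    proof eventually_elim
      case (elim x)
      have w: "\<alpha> * w x = - (\<sigma> x * grad_f ubar x)" using assms(11) by (simp add: w_def)
      have "\<bar>\<alpha> * (u k x - w x)\<bar> \<le> ?a x + (?b x + (?c x + ?e x))"
      proof (cases "u k x = 0")
        case True
        \<comment> \<open>Off the support of \<open>u k\<close> there is no stationarity equation,
          but the whole difference is the support error.\<close>
        then have "\<alpha> * (u k x - w x) = - e k x"
          by (simp add: right_diff_distrib w e_def abs0_def)
        then show ?thesis using assms(9) by simp
      next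
        case False
        \<comment> \<open>Stationarity reads
          \<open>\<alpha> * u k x = - grad_f (u m) x - L * (u k x - u m x)\<close>; the gradients at
          \<open>u k\<close> and at \<open>ubar\<close> are then added and subtracted.\<close>
        have *: "\<alpha> * (u k x - w x) = (grad_f (u k) x - grad_f (u m) x) - L * (u k x - u m x)
            - (grad_f (u k) x - grad_f ubar x) - e k x"
          using elim False by (simp add: right_diff_distrib w e_def abs0_def algebra_simps)
        have "\<bar>p - q - y - z\<bar> \<le> \<bar>p\<bar> + (\<bar>q\<bar> + (\<bar>y\<bar> + \<bar>z\<bar>))" for p q y z :: real
          by linarith
        then have "\<bar>\<alpha> * (u k x - w x)\<bar> \<le> ?a x + (\<bar>L * (u k x - u m x)\<bar> + (?c x + ?e x))"
          unfolding * .
        also have "\<bar>L * (u k x - u m x)\<bar> = ?b x" using assms(9) by (simp add: abs_mult)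
        finally show ?thesis .
      qed
      then show ?case by (rule order_trans) (rule abs_ge_self)
    qed
    have "\<alpha> * L2_norm \<Omega> (\<lambda>x. u k x - w x) = L2_norm \<Omega> (\<lambda>x. \<alpha> * (u k x - w x))"
      using assms(11) by (simp add: L2_norm_cmult)
    also have "\<dots> \<le> L2_norm \<Omega> (\<lambda>x. ?a x + (?b x + (?c x + ?e x)))"
      by (rule L2_norm_mono[OF _ _ ae])
        (intro L2_space_add L L2_space_measurable L2_space_cmult L2_space_diff uL wL)+
    also have "\<dots> \<le> L2_norm \<Omega> ?a + (L2_norm \<Omega> ?b + (L2_norm \<Omega> ?c + L2_norm \<Omega> ?e))"
      using L2_norm_triangle[OF L(3,4)] L2_norm_triangle[OF L(2) L2_space_add[OF L(3,4)]]
        L2_norm_triangle[OF L(1) L2_space_add[OF L(2) L2_space_add[OF L(3,4)]]] by linarith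
    also have "L2_norm \<Omega> ?a \<le> L\<^sub>f * d m"
      using assms(8) uL by (simp add: abs_norm L2_lipschitz_def d_def k)
    also have "L2_norm \<Omega> ?b = L * d m"
      using assms(9) by (simp add: L2_norm_cmult abs_norm d_def k)
    finally show ?thesis by (simp add: abs_norm k)
  qed

  have r1: "filterlim (\<lambda>n. r n - 1) sequentially sequentially"
    by (rule filterlim_compose[OF filterlim_minus_const_nat_at_top filterlim_subseq[OF r]])
  have "L2_strong_conv \<Omega> (\<lambda>n. grad_f (u (r n))) (grad_f ubar)"
    using assms(12) weak by (simp add: L2_completely_continuous_def)
  then have g_lim: "(\<lambda>n. L2_norm \<Omega> (\<lambda>x. grad_f (u (r n)) x - grad_f ubar x)) \<longlonglongrightarrow> 0"
    by (simp add: L2_strong_conv_def)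
  have "(\<lambda>n. \<alpha> * L2_norm \<Omega> (\<lambda>x. u (r n) x - w x)) \<longlonglongrightarrow> 0"
  proof (rule Lim_null_comparison)
    show "(\<lambda>n. L\<^sub>f * d (r n - 1) + (L * d (r n - 1)
        + (L2_norm \<Omega> (\<lambda>x. grad_f (u (r n)) x - grad_f ubar x) + L2_norm \<Omega> (e (r n))))) \<longlonglongrightarrow> 0"
      using filterlim_compose[OF d_lim r1] g_lim filterlim_compose[OF e_lim filterlim_subseq[OF r]]
      by (auto intro!: tendsto_eq_intros)
    show "\<forall>\<^sub>F n in sequentially. norm (\<alpha> * L2_norm \<Omega> (\<lambda>x. u (r n) x - w x))
        \<le> L\<^sub>f * d (r n - 1) + (L * d (r n - 1)
          + (L2_norm \<Omega> (\<lambda>x. grad_f (u (r n)) x - grad_f ubar x) + L2_norm \<Omega> (e (r n))))"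
      using eventually_ge_at_top[of 1]
    proof eventually_elim
      case (elim n)
      \<comment> \<open>A strictly increasing \<open>r\<close> satisfies \<open>r n \<ge> n\<close>,
        so the truncated subtraction in \<open>r n - 1\<close> is a true predecessor.\<close>
      then have "r n \<ge> 1" using seq_suble[OF r, of n] by simp
      then show ?case using est[of "r n"] assms(11) by simp
    qed
  qed
  then have strong: "L2_strong_conv \<Omega> (\<lambda>n. u (r n)) w"
    using assms(11) uL wL by (simp add: L2_strong_conv_def tendsto_mult_left_iff)
  have eq: "AE x in ?M. ubar x = w x"
    by (rule L2_weak_limit_eq_strong_limit[OF weak strong])
  \<comment> \<open>\<open>ubar\<close> and \<open>w\<close> are two representatives of one element,
    so distances to them agree.\<close>
  have "L2_norm \<Omega> (\<lambda>x. u (r n) x - ubar x) = L2_norm \<Omega> (\<lambda>x. u (r n) x - w x)" for n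
    by (intro antisym L2_norm_mono L2_space_measurable L2_space_diff uL ubarL wL)
      (use eq in \<open>eventually_elim, simp\<close>)+
  with strong ubarL have "L2_strong_conv \<Omega> (\<lambda>n. u (r n)) ubar"
    by (simp add: L2_strong_conv_def)
  \<comment> \<open>Where \<open>w\<close> is nonzero, \<sigma> is nonzero too and hence equal to
    1.\<close>
  moreover have "AE x in ?M. ubar x \<noteq> 0 \<longrightarrow> ubar x = - (1 / \<alpha>) * grad_f ubar x"
    using eq \<sigma> by eventually_elim (auto simp: w_def)
  ultimately show "L2_strong_conv \<Omega> (\<lambda>n. u (r n)) ubar \<and>
      (AE x in ?M. ubar x \<noteq> 0 \<longrightarrow> ubar x = - (1 / \<alpha>) * grad_f ubar x)" ..
qed

end
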